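(* Let $k$ be a field and let $f\in k[x]$ be nonzero. For any $\alpha\in k$, we have $\operatorname{tol}(f(x+\alpha))=\operatorname{tol}(f(x))$.
   Context: Let $k$ be a field with algebraic closure $\overline{k}$, and let $f=a_nx^n+\ldots+a_0\in k[x]$ with $a_n\neq 0$. Write $f=a_n\prod_{i=1}^s(x-r_i)^{m_i}$ over $\overline{k}$, where $r_1,\ldots,r_s$ are distinct and $m_i\geq 1$. The tolerant of $f$ is $\operatorname{tol}(f):=a_n^{2n-2}\prod_{1\leq i<j\leq s}(r_i-r_j)^{2m_im_j}$. *)

theory Defs
  imports
    "HOL-Algebra.Algebraic_Closure_Type"
    "HOL-Combinatorics.List_Permutation"
begin

text \<open>
  A list \<open>[(r\<^sub>1, m\<^sub>1), \<dots>, (r\<^sub>s, m\<^sub>s)]\<close> encodes the factorization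
  \<open>f = a\<^sub>n \<Prod> (x - r\<^sub>i) ^ m\<^sub>i\<close> over the algebraic closure, including the
  enumeration of the roots. For constant nonzero \<open>f\<close> it is the empty list.
\<close>

definition root_factorization :: "'a :: field poly \<Rightarrow> ('a alg_closure \<times> nat) list \<Rightarrow> bool" where
  "root_factorization f rms \<longleftrightarrow>
     distinct (map fst rms) \<and>
     (\<forall>(r, m)\<in>set rms. m \<ge> 1) \<and>
     map_poly to_ac f = Polynomial.smult (to_ac (Polynomial.lead_coeff f)) (\<Prod>(r, m)\<leftarrow>rms. [:- r, 1:] ^ m)"

definition tol_of :: "'a :: field poly \<Rightarrow> ('a alg_closure \<times> nat) list \<Rightarrow> 'a alg_closure" where
  "tol_of f rms =
     to_ac (Polynomial.lead_coeff f) powi (2 * int (Polynomial.degree f) - 2) *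
     (\<Prod>(i, j)\<in>{(i, j). i < j \<and> j < length rms}.
        (fst (rms ! i) - fst (rms ! j)) ^ (2 * snd (rms ! i) * snd (rms ! j)))"

text \<open>
  The tolerant is an element of the algebraic closure. The exponent \<open>2n - 2\<close> is an
  integer, so that a constant \<open>f = a\<^sub>0\<close> has tolerant \<open>a\<^sub>0\<^sup>-\<^sup>2\<close>. The choice of the
  factorization is possible and irrelevant for \<open>f \<noteq> 0\<close>, see \<open>root_factorization_exists\<close>
  and \<open>tol_eq_tol_of\<close> below.
\<close>

definition tol :: "'a :: field poly \<Rightarrow> 'a alg_closure" where
  "tol f = tol_of f (SOME rms. root_factorization f rms)"

lemma lead_coeff_map_poly_to_ac:
  "Polynomial.lead_coeff (map_poly to_ac f) = to_ac (Polynomial.lead_coeff f)"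
  by (cases "f = 0") (auto simp: coeff_map_poly degree_map_poly)

lemma root_factorization_exists:
  fixes f :: "'a :: field poly"
  assumes "f \<noteq> 0"
  shows "\<exists>rms. root_factorization f rms"
proof -
  define F where "F = map_poly to_ac f"
  have F0: "F \<noteq> 0"
    using assms by (simp add: F_def map_poly_eq_0_iff)
  obtain A where A: "F = Polynomial.smult (Polynomial.lead_coeff F) (\<Prod>x\<in>#A. [:- x, 1:])"
    using alg_closed_imp_factorization[OF F0] by blast
  obtain rs where rs: "set rs = set_mset A" "distinct rs"
    using finite_distinct_list[OF finite_set_mset[of A]] by blast
  define rms where "rms = map (\<lambda>r. (r, count A r)) rs"
  have "(\<Prod>x\<in>#A. [:- x, 1:]) = (\<Prod>r\<in>set_mset A. [:- r, 1:] ^ count A r)"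
    by (rule image_prod_mset_multiplicity)
  also have "\<dots> = (\<Prod>(r, m)\<leftarrow>rms. [:- r, 1:] ^ m)"
    using rs(2) by (simp add: rms_def prod.distinct_set_conv_list rs(1) [symmetric] comp_def)
  finally have "F = Polynomial.smult (to_ac (Polynomial.lead_coeff f)) (\<Prod>(r, m)\<leftarrow>rms. [:- r, 1:] ^ m)"
    using A by (simp add: F_def lead_coeff_map_poly_to_ac)
  moreover have "distinct (map fst rms)" "\<forall>(r, m)\<in>set rms. m \<ge> 1"
    using rs by (auto simp: rms_def comp_def Suc_le_eq)
  ultimately show ?thesis
    unfolding root_factorization_def F_def by blast
qed

lemma order_prod_linear_powers:
  fixes rms :: "('a :: field \<times> nat) list"
  assumes "distinct (map fst rms)"
  shows "Polynomial.order x (\<Prod>(r, m)\<leftarrow>rms. [:- r, 1:] ^ m)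
           = (case map_of rms x of None \<Rightarrow> 0 | Some m \<Rightarrow> m)"
  using assms
proof (induction rms)
  case Nil
  then show ?case by simp
next
  case (Cons p rms)
  obtain r m where p: "p = (r, m)" by force
  have nz: "(\<Prod>(r, m)\<leftarrow>rms. [:- r, 1:] ^ m) \<noteq> 0"
    by (auto simp: prod_list_zero_iff)
  have o: "Polynomial.order x ([:- r, 1:] ^ m) = (if x = r then m else 0)"
  proof (cases "x = r")
    case True
    then show ?thesis by (simp add: order_power_n_n)
  next
    case False
    then show ?thesis by (auto intro!: order_0I simp: poly_power)
  qed
  have "Polynomial.order x (\<Prod>(r, m)\<leftarrow>p # rms. [:- r, 1:] ^ m)
          = Polynomial.order x ([:- r, 1:] ^ m) + Polynomial.order x (\<Prod>(r, m)\<leftarrow>rms. [:- r, 1:] ^ m)"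
    unfolding p using nz by (simp add: order_mult)
  moreover have "map_of rms r = None"
    using Cons.prems p by (simp add: map_of_eq_None_iff)
  ultimately show ?case
    using Cons o by (auto simp: p)
qed

lemma root_factorization_set:
  assumes "f \<noteq> 0" "root_factorization f rms"
  shows "set rms = {(r, m). m \<ge> 1 \<and> m = Polynomial.order r (map_poly to_ac f)}"
proof -
  have d: "distinct (map fst rms)" and m: "\<And>r m. (r, m) \<in> set rms \<Longrightarrow> m \<ge> 1"
    using assms by (auto simp: root_factorization_def)
  have "Polynomial.order r (map_poly to_ac f) = (case map_of rms r of None \<Rightarrow> 0 | Some m \<Rightarrow> m)" for r
    using assms order_prod_linear_powers[OF d, of r] 
    by (simp add: root_factorization_def order_smult)
  then show ?thesis
    using m d by (auto simp: split: option.splits dest: map_of_SomeD)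
qed

lemma tol_of_cong:
  assumes "mset xs = mset ys"
  shows "tol_of f xs = tol_of f ys"
proof -
  define n where "n = length xs"
  have n: "length ys = n"
    using assms mset_eq_length n_def by metis
  obtain s where s: "bij_betw s {..<n} {..<n}" "\<And>i. i < n \<Longrightarrow> xs ! i = ys ! s i"
    using permutation_Ex_bij[OF assms] n n_def by auto
  define t where "t = inv_into {..<n} s"
  have t_bij: "bij_betw t {..<n} {..<n}"
    unfolding t_def by (rule bij_betw_inv_into[OF s(1)])
  have t: "t (s i) = i" "s (t i) = i" "s i < n" "t i < n" if "i < n" for i
    using that bij_betw_inv_into_left[OF s(1), of i] bij_betw_inv_into_right[OF s(1), of i]
      bij_betwE[OF s(1)] bij_betwE[OF t_bij] by (auto simp: t_def)
  define g :: "'a alg_closure \<times> nat \<Rightarrow> 'a alg_closure \<times> nat \<Rightarrow> 'a alg_closure"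
    where "g = (\<lambda>p q. (fst p - fst q) ^ (2 * snd p * snd q))"
  have g: "g p q = g q p" for p q
  proof -
    have "(fst p - fst q) ^ (2 * snd p * snd q) = ((fst p - fst q)\<^sup>2) ^ (snd p * snd q)"
      by (simp only: power_mult [symmetric] mult.assoc)
    also have "\<dots> = ((fst q - fst p)\<^sup>2) ^ (snd q * snd p)"
      by (simp only: power2_commute[of "fst p"] mult.commute[of "snd p"])
    also have "\<dots> = (fst q - fst p) ^ (2 * snd q * snd p)"
      by (simp only: power_mult [symmetric] mult.assoc)
    finally show ?thesis by (simp add: g_def)
  qed
  define P where "P = {(i, j). i < j \<and> j < n}"
  define sw where "sw = (\<lambda>u (i :: nat, j :: nat). (min (u i) (u j), max (u i) (u j :: nat)))"
  have sw_P: "sw v p \<in> P" and sw_inv: "sw u (sw v p) = p"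
    if "p \<in> P" "\<And>i. i < n \<Longrightarrow> u (v i) = i" "\<And>i. i < n \<Longrightarrow> v i < n" for u v p
  proof -
    obtain i j where p: "p = (i, j)" by force
    have ij: "i < j" "j < n" "i < n"
      using that(1) p by (auto simp: P_def)
    then have "v i \<noteq> v j" "u (v i) = i" "u (v j) = j" "v i < n" "v j < n"
      using that(2)[of i] that(2)[of j] that(3) by auto
    then show "sw v p \<in> P" "sw u (sw v p) = p"
      using ij by (auto simp: p P_def sw_def min_def max_def)
  qed
  have "(\<Prod>(i, j)\<in>P. g (xs ! i) (xs ! j)) = (\<Prod>(i, j)\<in>P. g (ys ! i) (ys ! j))"
  proof (rule prod.reindex_bij_witness[where i = "sw t" and j = "sw s"])
    fix p assume "p \<in> P"
    show "sw t (sw s p) = p" by (rule sw_inv[OF \<open>p \<in> P\<close>]) (fact t)+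
    show "sw s (sw t p) = p" by (rule sw_inv[OF \<open>p \<in> P\<close>]) (fact t)+
    show "sw s p \<in> P" by (rule sw_P[OF \<open>p \<in> P\<close>, of t s]) (fact t)+
    show "sw t p \<in> P" by (rule sw_P[OF \<open>p \<in> P\<close>, of s t]) (fact t)+
    obtain i j where p: "p = (i, j)" by force
    show "(case sw s p of (i, j) \<Rightarrow> g (ys ! i) (ys ! j)) = (case p of (i, j) \<Rightarrow> g (xs ! i) (xs ! j))"
      using \<open>p \<in> P\<close> g[of "ys ! s i" "ys ! s j"]
      by (auto simp: p P_def sw_def min_def max_def s(2))
  qed
  then show ?thesis
    by (simp add: tol_of_def g_def P_def n flip: n_def)
qed

lemma tol_eq_tol_of:
  assumes "f \<noteq> 0" "root_factorization f rms"
  shows "tol f = tol_of f rms"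
proof -
  define xs where "xs = (SOME rms. root_factorization f rms)"
  have xs: "root_factorization f xs"
    unfolding xs_def by (rule someI[of _ rms]) (fact assms(2))
  have "distinct xs" "distinct rms"
    using xs assms(2) by (auto simp: root_factorization_def distinct_map)
  moreover have "set xs = set rms"
    by (simp only: root_factorization_set[OF assms(1) xs] root_factorization_set[OF assms])
  ultimately have "mset xs = mset rms"
    by (simp add: set_eq_iff_mset_eq_distinct)
  then show ?thesis
    unfolding tol_def xs_def[symmetric] by (rule tol_of_cong)
qed

end

theory Submission
  imports Defs
begin

text \<open>
  The tolerant sees the roots only through their pairwise differences, and besides them
  only the leading coefficient, the degree and the multiplicities. Substituting
  \<open>x + \<alpha>\<close> for \<open>x\<close> moves every root from \<open>r\<close> to \<open>r - \<alpha>\<close> without changing its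
  multiplicity (\<open>root_factorization_pcompose_shift\<close>); all differences survive, and so do the
  leading coefficient and the degree. Hence a factorization of \<open>f\<close>, shifted root by root,
  is one of \<open>f(x + \<alpha>)\<close> in which every factor of the tolerant is the old one.
  As the tolerant may be computed from any factorization (\<open>tol_eq_tol_of\<close>), the two values agree.
\<close>

lemma map_poly_to_ac_add: "map_poly to_ac (p + q) = map_poly to_ac p + map_poly to_ac q"
  by (rule poly_eqI) (simp add: coeff_map_poly)

lemma map_poly_to_ac_mult: "map_poly to_ac (p * q) = map_poly to_ac p * map_poly to_ac q"
  by (rule poly_eqI) (simp add: coeff_map_poly coeff_mult to_ac_sum)

lemma map_poly_to_ac_pcompose:
  "map_poly to_ac (pcompose p q) = pcompose (map_poly to_ac p) (map_poly to_ac q)"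
  by (induction p)
    (simp_all add: pcompose_pCons map_poly_pCons map_poly_to_ac_add map_poly_to_ac_mult)

lemma pcompose_power: "pcompose (p ^ n) q = pcompose p q ^ n"
  for p q :: "'a :: comm_semiring_1 poly"
  by (induction n) (simp_all add: pcompose_1 pcompose_mult)

text \<open>
  The sign of the shift: each factor \<open>x - r\<close> turns into \<open>x + c - r = x - (r - c)\<close>.
\<close>

lemma pcompose_shift_prod_linear_powers:
  fixes c :: "'a :: idom"
  shows "pcompose (\<Prod>(r, m)\<leftarrow>rms. [:- r, 1:] ^ m) [:c, 1:]
           = (\<Prod>(r, m)\<leftarrow>map (\<lambda>(r, m). (r - c, m)) rms. [:- r, 1:] ^ m)"
  by (induction rms) (auto simp: pcompose_1 pcompose_mult pcompose_power pcompose_pCons)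

lemma lead_coeff_pcompose_shift:
  fixes f :: "'a :: idom poly"
  shows "Polynomial.lead_coeff (pcompose f [:c, 1:]) = Polynomial.lead_coeff f"
  by (subst lead_coeff_comp) auto

text \<open>
  Shifting by a constant is injective, so distinct roots stay distinct. Therefore the list
  of shifted roots is a genuine factorization, with no multiplicities to be merged.
\<close>

lemma root_factorization_pcompose_shift:
  assumes "root_factorization f rms"
  shows "root_factorization (pcompose f [:\<alpha>, 1:]) (map (\<lambda>(r, m). (r - to_ac \<alpha>, m)) rms)"
proof -
  let ?sh = "map (\<lambda>(r, m). (r - to_ac \<alpha>, m)) rms"
  have "map fst ?sh = map (\<lambda>r. r - to_ac \<alpha>) (map fst rms)"
    by auto
  moreover have "inj (\<lambda>r. r - to_ac \<alpha>)"
    by (auto intro: injI)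
  ultimately have "distinct (map fst ?sh)"
    using assms unfolding root_factorization_def
    by (metis distinct_map inj_on_subset subset_UNIV)
  moreover have "\<forall>(r, m)\<in>set ?sh. m \<ge> 1"
    using assms by (auto simp: root_factorization_def)
  moreover have "map_poly to_ac (pcompose f [:\<alpha>, 1:])
      = Polynomial.smult (to_ac (Polynomial.lead_coeff f)) (\<Prod>(r, m)\<leftarrow>?sh. [:- r, 1:] ^ m)"
    using assms
    by (simp add: root_factorization_def map_poly_to_ac_pcompose map_poly_pCons pcompose_smult
        pcompose_shift_prod_linear_powers del: map_map)
  ultimately show ?thesis
    unfolding root_factorization_def lead_coeff_pcompose_shift by blast
qed

lemma tol_of_pcompose_shift:
  "tol_of (pcompose f [:\<alpha>, 1:]) (map (\<lambda>(r, m). (r - c, m)) rms) = tol_of f rms"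
  unfolding tol_of_def lead_coeff_pcompose_shift
  by (auto simp: degree_pcompose case_prod_beta intro!: prod.cong)

theorem proposition2p1:
  fixes f :: "'k :: field poly" and \<alpha> :: 'k
  assumes "f \<noteq> 0"
  shows "tol (pcompose f [:\<alpha>, 1:]) = tol f"
proof -
  obtain rms where rms: "root_factorization f rms"
    using root_factorization_exists[OF assms] by blast
  have "pcompose f [:\<alpha>, 1:] \<noteq> 0"
    using assms by (simp add: pcompose_eq_0_iff)
  then show ?thesis
    using tol_eq_tol_of[OF _ root_factorization_pcompose_shift[OF rms]]
      tol_eq_tol_of[OF assms rms] tol_of_pcompose_shift by metis
qed

end
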